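(* Let $T$ be a thesaurus tree, let $N$ denote the number of leaf nodes of $T$, and let $S$ be a sample of nouns from the leaves of $T$. The algorithm Find-MDL, applied to $T$ (with sample $S$), terminates in time $O(N)$, and it outputs a tree cut model of $T$ with the minimum description length: the tree cut $\Gamma$ it returns, taken with its maximum likelihood parameters $\hat\theta$, satisfies $l((\Gamma,\hat\theta),S)\le l((\Gamma',\hat\theta'),S)$ for every tree cut $\Gamma'$ in $T$ with maximum likelihood parameters $\hat\theta'$.
   Context: **Thesaurus tree and tree cuts.** A thesaurus is a rooted tree in which each leaf node stands for a noun, each internal node represents a noun class (the set of nouns at the leaves below it), and a directed link represents set inclusion. A leaf is identified with the class consisting of its noun. $|C|$ denotes the number of nouns in class $C$. A tree cut in a tree is any set of nodes of the tree that represents a partition of the set of nouns at its leaves; tree cuts in a subtree are defined in the same way. **Sample.** $S$ is a multiset of nouns (leaves of $T$), $|S|$ is its size counted with multiplicity, and $f(C)$ is the number of elements of $S$ (with multiplicity) that are nouns in class $C$. $\log$ is base $2$. **Tree cut models.** A tree cut model is a pair $(\Gamma,\theta)$ where $\Gamma=[C_1,\dots,C_{k+1}]$ is a tree cut in $T$ and $\theta=[P(C_1),\dots,P(C_{k+1})]$ is a probability parameter vector with $\sum_{i=1}^{k+1} P(C_i)=1$. It defines a distribution on nouns by $P(n)=P(C)/|C|$ for $n\in C\in\Gamma$. The maximum likelihood parameters $\hat\theta$ for $\Gamma$ are $\hat P(C)=f(C)/|S|$, $C\in\Gamma$, giving $\hat P(n)=\hat P(C)/|C|$ for $n\in C\in\Gamma$.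 **Description length.** For a tree cut $\Gamma$ in $T$ with $k+1$ nodes and maximum likelihood parameters $\hat\theta$, $$l((\Gamma,\hat\theta),S)=\log|\mathcal G|+\frac{k}{2}\log|S|-\sum_{n\in S}\log\hat P(n),$$ where $\mathcal G$ is the set of all tree cuts in $T$ and the last sum is over the multiset $S$. The three terms are the model, parameter and data description lengths. **Quantity used by the algorithm.** For a tree cut $c$ with $k+1$ nodes in a subtree $t$ of $T$ (possibly $t=T$), $$L'(c)=\frac{k+1}{2}\log|S|-\sum_{n\in S_t}\log\hat P(n),$$ where $S_t$ is the sub-multiset of $S$ consisting of the nouns at leaves of $t$, $|S|$ is always the size of the entire sample, and $\hat P(n)=f(C)/(|S|\,|C|)$ for $n\in C\in c$. (The parameter term uses $k+1$ both for proper subtrees and for the entire tree.) **Algorithm Find-MDL($t$)** (initially $t$ is the entire tree $T$; it returns a tree cut in $t$): 1. If $t$ is a leaf node, return $[t]$. 2. Otherwise, for each child subtree $t_i$ of $t$ let $c_i:=$ Find-MDL($t_i$), and let $c$ be the result of appending all the $c_i$. 3. If $L'([\mathrm{root}(t)])<L'(c)$, return $[\mathrm{root}(t)]$; otherwise return $c$. Here $\mathrm{root}(t)$ is the root node of $t$. For simplicity the algorithm is described as outputting a tree cut rather than a tree cut model; the output model is the returned cut with its maximum likelihood parameters.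
   Formalization: The O(N) time bound is proved for trees whose links are proper inclusions (no internal node has an only child), since a chain of m internal nodes over one leaf has N=1 but needs m+1 calls; the minimum description length claim is proved for all thesaurus trees with a non-empty sample. *)

theory Defs
  imports Complex_Main "HOL-Library.Multiset" "HOL-Library.Disjoint_Sets"
begin

text \<open>A node is identified with the subtree hanging below it. This is unambiguous in a thesaurus
  tree: its leaves carry pairwise distinct nouns and every internal node has a leaf below it, so
  different positions carry different subtrees.\<close>

datatype 'a tree = Leaf 'a | Node "'a tree list"

primrec leaves :: "'a tree \<Rightarrow> 'a list" where
  "leaves (Leaf n) = [n]"
| "leaves (Node ts) = concat (map leaves ts)"

definition nouns :: "'a tree \<Rightarrow> 'a set" where
  "nouns t = set (leaves t)"

primrec nodes :: "'a tree \<Rightarrow> 'a tree set" where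
  "nodes (Leaf n) = {Leaf n}"
| "nodes (Node ts) = insert (Node ts) (\<Union> (set (map nodes ts)))"

definition thesaurus :: "'a tree \<Rightarrow> bool" where
  "thesaurus t \<longleftrightarrow> distinct (leaves t) \<and> (\<forall>ts. Node ts \<in> nodes t \<longrightarrow> ts \<noteq> [])"

text \<open>Every link is a proper inclusion of noun classes, that is, no internal node merely repeats
  the class of an only child. Without this, the number of nodes is not bounded in terms of the
  number of leaves.\<close>

definition proper_links :: "'a tree \<Rightarrow> bool" where
  "proper_links t \<longleftrightarrow> (\<forall>ts. Node ts \<in> nodes t \<longrightarrow> (\<forall>u \<in> set ts. nouns u \<subset> nouns (Node ts)))"

text \<open>Injectivity says that no class is represented by two nodes of the cut; it matters only for a
  node and its only child, which have the same class.\<close>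

definition tree_cut :: "'a tree \<Rightarrow> 'a tree set \<Rightarrow> bool" where
  "tree_cut t \<Gamma> \<longleftrightarrow> \<Gamma> \<subseteq> nodes t \<and> inj_on nouns \<Gamma> \<and> partition_on (nouns t) (nouns ` \<Gamma>)"

definition freq :: "'a multiset \<Rightarrow> 'a tree \<Rightarrow> nat" where
  "freq S C = size {#n \<in># S. n \<in> nouns C#}"

text \<open>A parameter vector is a function on nodes; only its values on the cut matter.\<close>

definition tree_cut_model :: "'a tree \<Rightarrow> 'a tree set \<times> ('a tree \<Rightarrow> real) \<Rightarrow> bool" where
  "tree_cut_model t = (\<lambda>(\<Gamma>, \<theta>). tree_cut t \<Gamma> \<and> (\<forall>C\<in>\<Gamma>. 0 \<le> \<theta> C) \<and> (\<Sum>C\<in>\<Gamma>. \<theta> C) = 1)"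

definition noun_prob :: "'a tree set \<times> ('a tree \<Rightarrow> real) \<Rightarrow> 'a \<Rightarrow> real" where
  "noun_prob = (\<lambda>(\<Gamma>, \<theta>) n. let C = (THE C. C \<in> \<Gamma> \<and> n \<in> nouns C) in \<theta> C / real (card (nouns C)))"

definition mle :: "'a multiset \<Rightarrow> 'a tree \<Rightarrow> real" where
  "mle S C = real (freq S C) / real (size S)"

definition description_length ::
  "'a tree \<Rightarrow> 'a tree set \<times> ('a tree \<Rightarrow> real) \<Rightarrow> 'a multiset \<Rightarrow> real" where
  "description_length T M S =
     log 2 (real (card {\<Gamma>. tree_cut T \<Gamma>}))
     + (real (card (fst M)) - 1) / 2 * log 2 (real (size S))
     - (\<Sum>n\<in>#S. log 2 (noun_prob M n))"

definition Lprime :: "'a multiset \<Rightarrow> 'a tree \<Rightarrow> 'a tree set \<Rightarrow> real" where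
  "Lprime S t c =
     real (card c) / 2 * log 2 (real (size S))
     - (\<Sum>n\<in>#{#n \<in># S. n \<in> nouns t#}. log 2 (noun_prob (c, mle S) n))"

fun find_mdl :: "'a multiset \<Rightarrow> 'a tree \<Rightarrow> 'a tree list" where
  "find_mdl S (Leaf n) = [Leaf n]"
| "find_mdl S (Node ts) =
     (let c = concat (map (find_mdl S) ts)
      in if Lprime S (Node ts) {Node ts} < Lprime S (Node ts) (set c) then [Node ts] else c)"

text \<open>Cost model: a unit-cost random access machine with real arithmetic. One unit of time is
  charged for every function call and for every primitive operation, namely: looking up the sample
  frequency of the noun at a leaf; a single addition, subtraction, multiplication, division,
  logarithm or comparison of numbers; prepending one node to a list. Sequencing and returning
  results are free. There are no other primitives: class frequencies, class sizes, the values of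
  L', the sample size and the appended lists are all computed from these.\<close>

datatype 'a timed = Timed (val: 'a) (time: nat)

definition ret :: "'a \<Rightarrow> 'a timed" where
  "ret x = Timed x 0"

definition step :: "'a \<Rightarrow> 'a timed" where
  "step x = Timed x 1"

definition call :: "'a timed \<Rightarrow> 'a timed" where
  "call m = Timed (val m) (time m + 1)"

definition seq :: "'a timed \<Rightarrow> ('a \<Rightarrow> 'b timed) \<Rightarrow> 'b timed"  (infixl "\<bind>" 54) where
  "m \<bind> f = Timed (val (f (val m))) (time m + time (f (val m)))"

fun sample_size_timed :: "'a multiset \<Rightarrow> 'a tree \<Rightarrow> nat timed"
  and sample_sizes_timed :: "'a multiset \<Rightarrow> 'a tree list \<Rightarrow> nat timed" where
  "sample_size_timed S (Leaf n) = call (step (count S n))"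
| "sample_size_timed S (Node ts) = call (sample_sizes_timed S ts)"
| "sample_sizes_timed S [] = call (ret 0)"
| "sample_sizes_timed S (t # ts) = call (
     sample_size_timed S t \<bind> (\<lambda>x.
     sample_sizes_timed S ts \<bind> (\<lambda>y.
     step (x + y))))"

text \<open>The value L' of the cut consisting of a single node, from the size m of the entire sample,
  its logarithm lg, the frequency f and the size s of the class of that node:
  L' = lg / 2 - f * log (f / (m * s)), where the second summand is absent if f = 0.\<close>

definition Lroot_timed :: "nat \<Rightarrow> real \<Rightarrow> nat \<Rightarrow> nat \<Rightarrow> real timed" where
  "Lroot_timed m lg f s = call (
     step (lg / 2) \<bind> (\<lambda>p.
     step (f = 0) \<bind> (\<lambda>b.
     if b then ret p
     else
       step (m * s) \<bind> (\<lambda>d.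
       step (real f / real d) \<bind> (\<lambda>q.
       step (log 2 q) \<bind> (\<lambda>e.
       step (real f * e) \<bind> (\<lambda>r.
       step (p - r))))))))"

text \<open>The run on a (list of) subtree(s) returns the computed cut prepended to the accumulator acc,
  the frequency and the size of the class, and the value of L' for the computed cut. Children are
  processed from right to left, so that the cuts get appended without ever being copied.\<close>

fun find_timed :: "'a multiset \<Rightarrow> nat \<Rightarrow> real \<Rightarrow> 'a tree \<Rightarrow> 'a tree list
      \<Rightarrow> ('a tree list \<times> nat \<times> nat \<times> real) timed"
  and finds_timed :: "'a multiset \<Rightarrow> nat \<Rightarrow> real \<Rightarrow> 'a tree list \<Rightarrow> 'a tree list
      \<Rightarrow> ('a tree list \<times> nat \<times> nat \<times> real) timed" where
  "find_timed S m lg (Leaf n) acc = call (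
     step (count S n) \<bind> (\<lambda>f.
     Lroot_timed m lg f 1 \<bind> (\<lambda>l.
     step (Leaf n # acc) \<bind> (\<lambda>c.
     ret (c, f, 1, l)))))"
| "find_timed S m lg (Node ts) acc = call (
     finds_timed S m lg ts acc \<bind> (\<lambda>(c, f, s, l).
     Lroot_timed m lg f s \<bind> (\<lambda>l'.
     step (l' < l) \<bind> (\<lambda>b.
     if b then step (Node ts # acc) \<bind> (\<lambda>c'. ret (c', f, s, l'))
     else ret (c, f, s, l)))))"
| "finds_timed S m lg [] acc = call (ret (acc, 0, 0, 0))"
| "finds_timed S m lg (t # ts) acc = call (
     finds_timed S m lg ts acc \<bind> (\<lambda>(c2, f2, s2, l2).
     find_timed S m lg t c2 \<bind> (\<lambda>(c1, f1, s1, l1).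
     step (f1 + f2) \<bind> (\<lambda>f.
     step (s1 + s2) \<bind> (\<lambda>s.
     step (l1 + l2) \<bind> (\<lambda>l.
     ret (c1, f, s, l)))))))"

definition find_mdl_timed :: "'a multiset \<Rightarrow> 'a tree \<Rightarrow> 'a tree list timed" where
  "find_mdl_timed S T = call (
     sample_size_timed S T \<bind> (\<lambda>m.
     step (log 2 (real m)) \<bind> (\<lambda>lg.
     find_timed S m lg T [] \<bind> (\<lambda>(c, f, s, l).
     ret c))))"

end

theory Submission
  imports Defs
begin

text \<open>Grouping the sample by the classes of a cut turns L' into a sum over the nodes of the cut of
  a cost that depends on the node only. A cut other than the root is a disjoint union of cuts of the
  child subtrees, so minimising L' is done independently in the children, and L' differs from the
  description length by a constant. For the running time, proper links force every internal
  node to have at least two children, so the number of nodes is less than twice the number of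
  leaves.\<close>

section \<open>Thesaurus trees and their cuts\<close>

lemma nouns_Leaf [simp]: "nouns (Leaf n) = {n}"
  by (simp add: nouns_def)

lemma nouns_Node [simp]: "nouns (Node ts) = (\<Union>u\<in>set ts. nouns u)"
  by (simp add: nouns_def)

lemma nodes_refl [simp]: "t \<in> nodes t"
  by (cases t) auto

lemma finite_nodes: "finite (nodes t)"
  by (induction t) auto

lemma nodes_trans: "u \<in> nodes t \<Longrightarrow> nodes u \<subseteq> nodes t"
  by (induction t) auto

lemma nouns_mono: "u \<in> nodes t \<Longrightarrow> nouns u \<subseteq> nouns t"
  by (induction t) auto

lemma card_nouns: "thesaurus t \<Longrightarrow> card (nouns t) = length (leaves t)"
  by (simp add: thesaurus_def nouns_def distinct_card)

lemma thesaurus_child: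
  assumes "thesaurus (Node ts)" "u \<in> set ts"
  shows "thesaurus u"
proof -
  obtain xs ys where "ts = xs @ u # ys"
    using split_list[OF assms(2)] by blast
  then show ?thesis
    using assms(1) by (auto simp: thesaurus_def)
qed

lemma thesaurus_children_nonempty: "thesaurus (Node ts) \<Longrightarrow> ts \<noteq> []"
  by (simp add: thesaurus_def)

text \<open>An internal node has a first child, so descending to first children ends at a leaf.
  Nonempty classes are what lets disjointness of classes separate nodes.\<close>

lemma nouns_nonempty:
  assumes "thesaurus t" "u \<in> nodes t"
  shows "nouns u \<noteq> {}"
  using assms(2)
proof (induction u)
  case (Node ts)
  then have "ts \<noteq> []"
    using assms(1) by (auto simp: thesaurus_def)
  then have "hd ts \<in> set ts"
    by simp
  moreover from this have "hd ts \<in> nodes t"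
    using nodes_trans[OF Node.prems] by force
  ultimately show ?case
    using Node.IH by fastforce
qed simp

lemma thesaurus_children:
  assumes "thesaurus (Node ts)"
  shows "distinct ts"
    and "\<lbrakk>u \<in> set ts; v \<in> set ts; n \<in> nouns u; n \<in> nouns v\<rbrakk> \<Longrightarrow> u = v"
proof -
  have ne: "leaves u \<noteq> []" if "u \<in> set ts" for u
    using nouns_nonempty[OF thesaurus_child[OF assms that] nodes_refl] by (auto simp: nouns_def)
  have d: "distinct (concat (map leaves ts))"
    using assms by (simp add: thesaurus_def)
  \<comment> \<open>\<open>distinct_concat_iff\<close> yields distinctness only after empty lists
    are removed; no leaf list is empty, so none is lost.\<close>
  have "removeAll [] (map leaves ts) = map leaves ts"
    using ne by (intro removeAll_id) force
  then have dm: "distinct (map leaves ts)"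
    using d by (simp add: distinct_concat_iff)
  then show "distinct ts"
    by (simp add: distinct_map)
  show "u = v" if "u \<in> set ts" "v \<in> set ts" "n \<in> nouns u" "n \<in> nouns v"
  proof (rule ccontr)
    assume "u \<noteq> v"
    then have "leaves u \<noteq> leaves v"
      using dm that by (auto simp: distinct_map dest: inj_onD)
    then have "set (leaves u) \<inter> set (leaves v) = {}"
      using d that by (auto simp: distinct_concat_iff)
    then show False
      using that by (auto simp: nouns_def)
  qed
qed

lemma nodes_children_disjoint:
  assumes "thesaurus (Node ts)" "u \<in> set ts" "v \<in> set ts" "C \<in> nodes u" "C \<in> nodes v"
  shows "u = v"
proof -
  obtain n where "n \<in> nouns C"
    using nouns_nonempty[OF thesaurus_child[OF assms(1,2)] assms(4)] by blast
  then show ?thesis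
    using thesaurus_children(2)[OF assms(1-3)] nouns_mono assms(4,5) by blast
qed

text \<open>The working form of a cut. Blocks that share a noun coincide, and injectivity turns
  equal classes into equal nodes; conversely, since classes are nonempty, unique covering gives back
  both injectivity and a partition.\<close>

lemma tree_cut_iff:
  assumes "thesaurus t"
  shows "tree_cut t \<Gamma> \<longleftrightarrow> \<Gamma> \<subseteq> nodes t \<and> (\<forall>n\<in>nouns t. \<exists>!C. C \<in> \<Gamma> \<and> n \<in> nouns C)"
proof (intro iffI conjI ballI)
  assume *: "tree_cut t \<Gamma>"
  then show "\<Gamma> \<subseteq> nodes t"
    by (simp add: tree_cut_def)
  fix n assume "n \<in> nouns t"
  then obtain C where C: "C \<in> \<Gamma>" "n \<in> nouns C"
    using * unfolding tree_cut_def partition_on_def by blast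
  moreover have "D = C" if "D \<in> \<Gamma>" "n \<in> nouns D" for D
  proof -
    have "nouns D = nouns C"
      using * that C unfolding tree_cut_def partition_on_def disjoint_def by blast
    then show ?thesis
      using * that C by (auto simp: tree_cut_def dest: inj_onD)
  qed
  ultimately show "\<exists>!C. C \<in> \<Gamma> \<and> n \<in> nouns C"
    by blast
next
  assume *: "\<Gamma> \<subseteq> nodes t \<and> (\<forall>n\<in>nouns t. \<exists>!C. C \<in> \<Gamma> \<and> n \<in> nouns C)"
  then have sub: "nouns C \<subseteq> nouns t" and ne: "nouns C \<noteq> {}" if "C \<in> \<Gamma>" for C
    using that nouns_mono nouns_nonempty[OF assms] by blast+
  have uniq: "C = D" if "C \<in> \<Gamma>" "D \<in> \<Gamma>" "n \<in> nouns C" "n \<in> nouns D" for C D n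
    using * that sub by blast
  have "inj_on nouns \<Gamma>"
    using uniq ne by (intro inj_onI) blast
  moreover have "partition_on (nouns t) (nouns ` \<Gamma>)"
  proof (rule partition_onI)
    show "\<Union> (nouns ` \<Gamma>) = nouns t"
      using * sub by blast
    show "disjnt p q" if "p \<in> nouns ` \<Gamma>" "q \<in> nouns ` \<Gamma>" "p \<noteq> q" for p q
      using that uniq unfolding disjnt_def by blast
    show "{} \<notin> nouns ` \<Gamma>"
      using ne by blast
  qed
  ultimately show "tree_cut t \<Gamma>"
    using * by (simp add: tree_cut_def)
qed

lemma finite_tree_cut: "tree_cut t \<Gamma> \<Longrightarrow> finite \<Gamma>"
  using finite_nodes finite_subset by (auto simp: tree_cut_def)

lemma tree_cut_root: "thesaurus t \<Longrightarrow> tree_cut t {t}"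
  by (auto simp: tree_cut_iff)

lemma tree_cut_Leaf_iff: "tree_cut (Leaf n) \<Gamma> \<longleftrightarrow> \<Gamma> = {Leaf n}"
proof -
  have "thesaurus (Leaf n)"
    by (simp add: thesaurus_def)
  from tree_cut_iff[OF this] show ?thesis
    by auto
qed

text \<open>A noun lies in the class of one child only, so any node covering it comes from the cut
  of that child, where it is unique.\<close>

lemma tree_cut_UN:
  assumes T: "thesaurus (Node ts)" and c: "\<And>u. u \<in> set ts \<Longrightarrow> tree_cut u (c u)"
  shows "tree_cut (Node ts) (\<Union>u\<in>set ts. c u)"
  unfolding tree_cut_iff[OF T]
proof (intro conjI ballI)
  have c': "c u \<subseteq> nodes u" "\<And>n. n \<in> nouns u \<Longrightarrow> \<exists>!C. C \<in> c u \<and> n \<in> nouns C"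
    if "u \<in> set ts" for u
    using c[OF that] tree_cut_iff[OF thesaurus_child[OF T that]] by auto
  then show "(\<Union>u\<in>set ts. c u) \<subseteq> nodes (Node ts)"
    by fastforce
  fix n assume "n \<in> nouns (Node ts)"
  then obtain u where u: "u \<in> set ts" "n \<in> nouns u"
    by auto
  have "C \<in> c u" if "v \<in> set ts" "C \<in> c v" "n \<in> nouns C" for v C
  proof -
    have "n \<in> nouns v"
      using c'(1)[OF that(1)] that nouns_mono by blast
    then show ?thesis
      using thesaurus_children(2)[OF T] u that by blast
  qed
  then show "\<exists>!C. C \<in> (\<Union>u\<in>set ts. c u) \<and> n \<in> nouns C"
    using c'(2)[OF u] u(1) by blast
qed

text \<open>The converse decomposition. A root in the cut shares a noun with every other node and so
  excludes it; without the root, each node lies below some child, and the cut restricts to a cut of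
  each child.\<close>

lemma tree_cut_NodeE:
  assumes T: "thesaurus (Node ts)" and cut: "tree_cut (Node ts) \<Gamma>"
  obtains "\<Gamma> = {Node ts}"
  | c where "\<And>u. u \<in> set ts \<Longrightarrow> tree_cut u (c u)" "\<Gamma> = (\<Union>u\<in>set ts. c u)"
proof (cases "Node ts \<in> \<Gamma>")
  case True
  have "C = Node ts" if "C \<in> \<Gamma>" for C
  proof -
    have "C \<in> nodes (Node ts)"
      using cut that by (auto simp: tree_cut_def)
    then obtain n where "n \<in> nouns C" "n \<in> nouns (Node ts)"
      using nouns_nonempty[OF T] nouns_mono by blast
    then show ?thesis
      using cut that True unfolding tree_cut_iff[OF T] by blast
  qed
  then show ?thesis
    using True that(1) by blast
next
  case False
  define c where "c u = \<Gamma> \<inter> nodes u" for u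
  have un: "\<Gamma> = (\<Union>u\<in>set ts. c u)"
    using cut False by (auto simp: c_def tree_cut_def)
  moreover have "tree_cut u (c u)" if u: "u \<in> set ts" for u
    unfolding tree_cut_iff[OF thesaurus_child[OF T u]]
  proof (intro conjI ballI)
    fix n assume n: "n \<in> nouns u"
    then have ex1: "\<exists>!C. C \<in> \<Gamma> \<and> n \<in> nouns C"
      using cut u by (auto simp: tree_cut_iff[OF T])
    then obtain C v where C: "C \<in> \<Gamma>" "n \<in> nouns C" "v \<in> set ts" "C \<in> nodes v"
      using un unfolding c_def by blast
    then have "v = u"
      using thesaurus_children(2)[OF T _ u _ n] nouns_mono by blast
    then show "\<exists>!C. C \<in> c u \<and> n \<in> nouns C"
      using C ex1 unfolding c_def by blast
  qed (simp add: c_def)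
  ultimately show ?thesis
    using that(2) by blast
qed

section \<open>Additivity of the description length over a cut\<close>

text \<open>Double counting: each occurrence of a noun of \<open>t\<close> is charged to the one
  node covering it, and nouns outside \<open>t\<close> count on neither side. The weight
  \<open>g\<close> is a log-probability for L' and the constant 1 for frequencies.\<close>

lemma sum_mset_tree_cut:
  fixes g :: "'a tree \<Rightarrow> real"
  assumes T: "thesaurus t" and cut: "tree_cut t \<Gamma>"
  shows "(\<Sum>n\<in>#{#n \<in># S. n \<in> nouns t#}. g (THE C. C \<in> \<Gamma> \<and> n \<in> nouns C))
    = (\<Sum>C\<in>\<Gamma>. real (freq S C) * g C)"
proof (induction S)
  case (add n S)
  have freq: "real (freq (add_mset n S) C) * g C
      = real (freq S C) * g C + (if n \<in> nouns C then g C else 0)" for C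
    by (simp add: freq_def algebra_simps)
  \<comment> \<open>A newly added noun raises the frequency of its covering node and of no other
    node of the cut.\<close>
  have "(\<Sum>C\<in>\<Gamma>. if n \<in> nouns C then g C else 0)
      = (if n \<in> nouns t then g (THE C. C \<in> \<Gamma> \<and> n \<in> nouns C) else 0)"
  proof (cases "n \<in> nouns t")
    case True
    then have ex1: "\<exists>!C. C \<in> \<Gamma> \<and> n \<in> nouns C"
      using cut by (simp add: tree_cut_iff[OF T])
    define D where "D = (THE C. C \<in> \<Gamma> \<and> n \<in> nouns C)"
    have D: "D \<in> \<Gamma>" "n \<in> nouns D"
      using theI'[OF ex1] by (auto simp: D_def)
    have "(\<Sum>C\<in>\<Gamma>. if n \<in> nouns C then g C else 0) = (\<Sum>C\<in>\<Gamma>. if C = D then g C else 0)"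
      using ex1 D by (intro sum.cong refl) metis
    then show ?thesis
      using True D(1) finite_tree_cut[OF cut] by (simp add: D_def)
  next
    case False
    then have "n \<notin> nouns C" if "C \<in> \<Gamma>" for C
      using cut that nouns_mono by (fastforce simp: tree_cut_def)
    then show ?thesis
      using False by simp
  qed
  then show ?case
    using add.IH by (simp add: freq sum.distrib)
qed (simp add: freq_def)

text \<open>The share of one node in L': half a logarithm for its parameter plus the code length of
  its nouns. At frequency 0 the second part vanishes, whatever the value of \<open>log\<close> at
  0.\<close>

definition node_cost :: "'a multiset \<Rightarrow> 'a tree \<Rightarrow> real" where
  "node_cost S C = log 2 (real (size S)) / 2
     - real (freq S C) * log 2 (mle S C / real (card (nouns C)))"

lemma Lprime_eq:
  assumes "thesaurus t" "tree_cut t \<Gamma>"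
  shows "Lprime S t \<Gamma> = (\<Sum>C\<in>\<Gamma>. node_cost S C)"
  using sum_mset_tree_cut[OF assms, of "\<lambda>C. log 2 (mle S C / real (card (nouns C)))" S]
  by (simp add: Lprime_def noun_prob_def Let_def node_cost_def sum_subtractf)

lemma filter_mset_nouns_eq: "set_mset S \<subseteq> nouns t \<Longrightarrow> {#n \<in># S. n \<in> nouns t#} = S"
  by (auto simp: filter_mset_eq_conv)

text \<open>The parameter terms count \<open>k\<close> here and \<open>k + 1\<close> in L', which
  costs half a logarithm. The difference is the same for all cuts, so both quantities have the same
  minimisers.\<close>

lemma description_length_eq:
  assumes "set_mset S \<subseteq> nouns t"
  shows "description_length t (\<Gamma>, mle S) S
    = log 2 (real (card {\<Gamma>. tree_cut t \<Gamma>})) - log 2 (real (size S)) / 2 + Lprime S t \<Gamma>"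
  by (simp add: description_length_def Lprime_def filter_mset_nouns_eq[OF assms] field_simps)

lemma tree_cut_model_mle:
  assumes "thesaurus t" "tree_cut t \<Gamma>" "set_mset S \<subseteq> nouns t" "S \<noteq> {#}"
  shows "tree_cut_model t (\<Gamma>, mle S)"
proof -
  have "(\<Sum>C\<in>\<Gamma>. real (freq S C)) = real (size S)"
    using sum_mset_tree_cut[OF assms(1,2), of "\<lambda>_. 1" S]
    by (simp add: filter_mset_nouns_eq[OF assms(3)])
  then show ?thesis
    using assms(2,4)
    by (simp add: tree_cut_model_def mle_def flip: sum_divide_distrib)
qed

lemma sum_children:
  fixes g :: "'a tree \<Rightarrow> real"
  assumes T: "thesaurus (Node ts)" and c: "\<And>u. u \<in> set ts \<Longrightarrow> c u \<subseteq> nodes u"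
  shows "(\<Sum>C\<in>(\<Union>u\<in>set ts. c u). g C) = (\<Sum>u\<in>set ts. \<Sum>C\<in>c u. g C)"
proof (rule sum.UNION_disjoint)
  show "\<forall>u\<in>set ts. finite (c u)"
    using c finite_nodes finite_subset by blast
  show "\<forall>u\<in>set ts. \<forall>v\<in>set ts. u \<noteq> v \<longrightarrow> c u \<inter> c v = {}"
    using c nodes_children_disjoint[OF T] by blast
qed simp

section \<open>Optimality of Find-MDL\<close>

lemma tree_cut_children_find_mdl:
  assumes "thesaurus (Node ts)" "\<And>u. u \<in> set ts \<Longrightarrow> tree_cut u (set (find_mdl S u))"
  shows "tree_cut (Node ts) (set (concat (map (find_mdl S) ts)))"
  using tree_cut_UN[OF assms(1), of "\<lambda>u. set (find_mdl S u)"] assms(2) by simp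

lemma tree_cut_find_mdl: "thesaurus t \<Longrightarrow> tree_cut t (set (find_mdl S t))"
proof (induction t)
  case (Leaf n)
  then show ?case by (simp add: tree_cut_Leaf_iff)
next
  case (Node ts)
  then have "tree_cut (Node ts) (set (concat (map (find_mdl S) ts)))"
    using tree_cut_children_find_mdl thesaurus_child by blast
  then show ?case
    using tree_cut_root[OF Node.prems] by (simp add: Let_def)
qed

lemma find_mdl_subset_nodes: "thesaurus t \<Longrightarrow> set (find_mdl S t) \<subseteq> nodes t"
  using tree_cut_find_mdl by (auto simp: tree_cut_def)

lemma distinct_find_mdl: "thesaurus t \<Longrightarrow> distinct (find_mdl S t)"
proof (induction t)
  case (Node ts)
  note T = Node.prems
  have ne: "find_mdl S u \<noteq> []" if "u \<in> set ts" for u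
    using tree_cut_find_mdl[OF thesaurus_child[OF T that], of S]
      nouns_nonempty[OF thesaurus_child[OF T that] nodes_refl]
    by (auto simp: tree_cut_def partition_on_def)
  have disj: "set (find_mdl S u) \<inter> set (find_mdl S v) = {}"
    if "u \<in> set ts" "v \<in> set ts" "u \<noteq> v" for u v
    using find_mdl_subset_nodes[OF thesaurus_child[OF T]] nodes_children_disjoint[OF T] that
    by blast
  \<comment> \<open>Disjoint lists can be equal only if they are empty, which the cuts of the
    children are not.\<close>
  have "inj_on (find_mdl S) (set ts)"
    using ne disj by (intro inj_onI) (metis inf.idem set_empty)
  then have "distinct (map (find_mdl S) ts)"
    using thesaurus_children(1)[OF T] by (simp add: distinct_map)
  then have "distinct (concat (map (find_mdl S) ts))"
    using disj Node.IH thesaurus_child[OF T] by (intro distinct_concat) auto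
  then show ?case
    by (simp add: Let_def)
qed simp

lemma find_mdl_Node:
  assumes T: "thesaurus (Node ts)"
  shows "find_mdl S (Node ts)
    = (if node_cost S (Node ts) < (\<Sum>C\<in>set (concat (map (find_mdl S) ts)). node_cost S C)
       then [Node ts] else concat (map (find_mdl S) ts))"
proof -
  have "tree_cut (Node ts) (set (concat (map (find_mdl S) ts)))"
    by (intro tree_cut_children_find_mdl T tree_cut_find_mdl thesaurus_child[OF T])
  then show ?thesis
    using Lprime_eq[OF T, of _ S] tree_cut_root[OF T] by (simp add: Let_def)
qed

text \<open>The returned cost is the minimum of the root cost and the cost of the appended cuts. The
  first bounds the root cut; any other cut splits into cuts of the children, each bounded by the
  induction hypothesis.\<close>

lemma sum_node_cost_find_mdl_le:
  assumes "thesaurus t" "tree_cut t \<Gamma>"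
  shows "(\<Sum>C\<in>set (find_mdl S t). node_cost S C) \<le> (\<Sum>C\<in>\<Gamma>. node_cost S C)"
  using assms
proof (induction t arbitrary: \<Gamma>)
  case (Leaf n)
  then show ?case by (simp add: tree_cut_Leaf_iff)
next
  case (Node ts)
  note T = Node.prems(1)
  define c where "c = concat (map (find_mdl S) ts)"
  note find = find_mdl_Node[OF T, of S, folded c_def]
  from T Node.prems(2) show ?case
  proof (cases rule: tree_cut_NodeE)
    case 1
    then show ?thesis by (simp add: find del: find_mdl.simps)
  next
    case (2 d)
    have "(\<Sum>C\<in>set c. node_cost S C) = (\<Sum>u\<in>set ts. \<Sum>C\<in>set (find_mdl S u). node_cost S C)"
      using sum_children[OF T, of "\<lambda>u. set (find_mdl S u)"]
        find_mdl_subset_nodes[OF thesaurus_child[OF T]]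
      by (simp add: c_def)
    also have "\<dots> \<le> (\<Sum>u\<in>set ts. \<Sum>C\<in>d u. node_cost S C)"
      using Node.IH 2(1) thesaurus_child[OF T] by (intro sum_mono) blast
    also have "\<dots> = (\<Sum>C\<in>\<Gamma>. node_cost S C)"
      unfolding 2(2) using 2(1) by (intro sum_children[OF T, symmetric]) (auto simp: tree_cut_def)
    finally show ?thesis
      by (simp add: find del: find_mdl.simps)
  qed
qed

section \<open>The timed implementation\<close>

lemma timed_simps:
  "val (ret x) = x" "time (ret x) = 0"
  "val (step x) = x" "time (step x) = 1"
  "val (call m) = val m" "time (call m) = time m + 1"
  "val (m \<bind> f) = val (f (val m))" "time (m \<bind> f) = time m + time (f (val m))"
  by (simp_all add: ret_def step_def call_def seq_def)

text \<open>The children themselves form a cut of their parent; weight 1 then turns the grouped sum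
  into frequencies.\<close>

lemma freq_children:
  assumes T: "thesaurus (Node ts)"
  shows "freq S (Node ts) = (\<Sum>u\<leftarrow>ts. freq S u)"
proof -
  have "tree_cut (Node ts) (\<Union>u\<in>set ts. {u})"
    by (intro tree_cut_UN[OF T] tree_cut_root thesaurus_child[OF T])
  then have "real (freq S (Node ts)) = (\<Sum>u\<in>set ts. real (freq S u))"
    using sum_mset_tree_cut[OF T, of "set ts" "\<lambda>_. 1" S] by (simp add: freq_def)
  then show ?thesis
    using thesaurus_children(1)[OF T]
    by (simp add: sum_list_distinct_conv_sum_set flip: of_nat_sum)
qed

lemma val_sample_size_timed:
  "val (sample_size_timed S t) = (\<Sum>n\<leftarrow>leaves t. count S n)"
  "val (sample_sizes_timed S ts) = (\<Sum>n\<leftarrow>concat (map leaves ts). count S n)"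
  by (induction S t and S ts rule: sample_size_timed_sample_sizes_timed.induct)
    (simp_all add: timed_simps)

lemma size_eq_sum_leaves:
  assumes "thesaurus t" "set_mset S \<subseteq> nouns t"
  shows "(\<Sum>n\<leftarrow>leaves t. count S n) = size S"
proof -
  have "size S = (\<Sum>n\<in>nouns t. count S n)"
    unfolding size_multiset_overloaded_eq
    using assms(2) by (intro sum.mono_neutral_left) (auto simp: nouns_def not_in_iff)
  then show ?thesis
    using assms(1) by (simp add: thesaurus_def nouns_def sum_list_distinct_conv_sum_set)
qed

text \<open>The branch at frequency 0 is sound because the skipped logarithm would be multiplied by
  0.\<close>

lemma val_Lroot_timed:
  "val (Lroot_timed (size S) (log 2 (real (size S))) (freq S C) (card (nouns C))) = node_cost S C"
  by (simp add: Lroot_timed_def timed_simps node_cost_def mle_def)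

text \<open>The results for the children are kept abstract, and the accumulator arbitrary, so that
  the induction hypothesis on trees can be plugged in.\<close>

lemma val_finds_timed:
  assumes "\<And>u acc. u \<in> set ts \<Longrightarrow> val (find_timed S m lg u acc) = (c u @ acc, f u, s u, l u)"
  shows "val (finds_timed S m lg ts acc)
    = (concat (map c ts) @ acc, \<Sum>u\<leftarrow>ts. f u, \<Sum>u\<leftarrow>ts. s u, \<Sum>u\<leftarrow>ts. l u)"
  using assms by (induction ts) (simp_all add: timed_simps)

text \<open>The number passed upward is the cost of the computed cut, so the timed comparison
  decides exactly as \<open>find_mdl_Node\<close> does.\<close>

lemma val_find_timed:
  assumes "thesaurus t"
  shows "val (find_timed S (size S) (log 2 (real (size S))) t acc)
    = (find_mdl S t @ acc, freq S t, card (nouns t), \<Sum>C\<in>set (find_mdl S t). node_cost S C)"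
  using assms
proof (induction t arbitrary: acc)
  case (Leaf n)
  have "count S n = freq S (Leaf n)"
    by (simp add: freq_def count_conv_size_mset)
  then show ?case
    using val_Lroot_timed[of S "Leaf n"] by (simp add: timed_simps)
next
  case (Node ts)
  note T = Node.prems
  define c where "c = concat (map (find_mdl S) ts)"
  note find = find_mdl_Node[OF T, of S, folded c_def]
  \<comment> \<open>Class sizes add up because they are lengths of leaf lists, which are
    concatenated.\<close>
  have "card (nouns (Node ts)) = (\<Sum>u\<leftarrow>ts. card (nouns u))"
    using card_nouns[OF T] card_nouns[OF thesaurus_child[OF T]]
    by (simp add: length_concat comp_def cong: map_cong)
  moreover have "(\<Sum>u\<leftarrow>ts. \<Sum>C\<in>set (find_mdl S u). node_cost S C) = (\<Sum>C\<in>set c. node_cost S C)"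
    using sum_children[OF T, of "\<lambda>u. set (find_mdl S u)"]
      find_mdl_subset_nodes[OF thesaurus_child[OF T]] thesaurus_children(1)[OF T]
    by (simp add: c_def sum_list_distinct_conv_sum_set)
  ultimately have "val (finds_timed S (size S) (log 2 (real (size S))) ts acc)
      = (c @ acc, freq S (Node ts), card (nouns (Node ts)), \<Sum>C\<in>set c. node_cost S C)"
    using val_finds_timed[OF Node.IH[OF _ thesaurus_child[OF T]]] freq_children[OF T]
    by (simp add: c_def)
  then show ?case
    using val_Lroot_timed[of S "Node ts"]
    by (simp add: timed_simps find del: nouns_Node find_mdl.simps)
qed

lemma val_find_mdl_timed:
  assumes "thesaurus t" "set_mset S \<subseteq> nouns t"
  shows "val (find_mdl_timed S t) = find_mdl S t"
  using val_find_timed[OF assms(1), of S "[]"]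
  by (simp add: find_mdl_timed_def timed_simps val_sample_size_timed size_eq_sum_leaves[OF assms])

section \<open>Running time\<close>

lemma proper_links_child:
  "proper_links (Node ts) \<Longrightarrow> u \<in> set ts \<Longrightarrow> proper_links u"
  using nodes_trans[of u "Node ts"] nodes_refl[of u] unfolding proper_links_def
  by (metis UN_I insertI2 list.set_map nodes.simps(2) subsetD)

text \<open>An only child has the class of its parent, so that link would not be a proper
  inclusion.\<close>

lemma two_le_length_children:
  assumes "thesaurus (Node ts)" "proper_links (Node ts)"
  shows "2 \<le> length ts"
proof (rule ccontr)
  assume "\<not> 2 \<le> length ts"
  then obtain u where "ts = [u]"
    using thesaurus_children_nonempty[OF assms(1)] by (cases ts) (auto simp: Suc_le_eq)
  then show False
    using assms(2) by (auto simp: proper_links_def)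
qed

text \<open>The longest branch makes one call and seven primitive operations.\<close>

lemma time_Lroot_timed: "time (Lroot_timed m lg f s) \<le> 8"
  by (simp add: Lroot_timed_def timed_simps)

text \<open>Of the 6 units saved at each child, its call and addition use 2 and 4 remain; the 1 is
  the call on the empty list.\<close>

lemma time_sample_sizes_timed:
  assumes "\<And>u. u \<in> set ts \<Longrightarrow> time (sample_size_timed S u) + 6 \<le> 8 * length (leaves u)"
  shows "time (sample_sizes_timed S ts) + 4 * length ts \<le> 1 + 8 * length (leaves (Node ts))"
  using assms
proof (induction ts)
  case (Cons u ts)
  then have "time (sample_sizes_timed S ts) + 4 * length ts \<le> 1 + 8 * length (leaves (Node ts))"
    by simp
  moreover have "time (sample_size_timed S u) + 6 \<le> 8 * length (leaves u)"
    using Cons.prems by simp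
  ultimately show ?case
    by (simp add: timed_simps)
qed (simp add: timed_simps)

text \<open>The summand subtracted from the multiple of the number of leaves pays, once per child,
  for the work at an internal node; hence the induction needs two children.\<close>

lemma time_sample_size_timed:
  assumes "thesaurus t" "proper_links t"
  shows "time (sample_size_timed S t) + 6 \<le> 8 * length (leaves t)"
  using assms
proof (induction t)
  case (Node ts)
  then have "time (sample_sizes_timed S ts) + 4 * length ts \<le> 1 + 8 * length (leaves (Node ts))"
    using thesaurus_child proper_links_child by (intro time_sample_sizes_timed) blast
  \<comment> \<open>Two children contribute 8 saved units: 2 pay for this call and the one on the
    empty list, 6 are passed on.\<close>
  then show ?case
    using two_le_length_children[OF Node.prems] by (simp add: timed_simps)
qed (simp add: timed_simps)

text \<open>Of the 20 units saved at each child, its call and three additions use 4 and 16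
  remain.\<close>

lemma time_finds_timed:
  assumes "\<And>u acc. u \<in> set ts \<Longrightarrow> time (find_timed S m lg u acc) + 20 \<le> 32 * length (leaves u)"
  shows "time (finds_timed S m lg ts acc) + 16 * length ts \<le> 1 + 32 * length (leaves (Node ts))"
  using assms
proof (induction ts)
  case (Cons u ts)
  \<comment> \<open>The run on \<open>u\<close> starts from the accumulator left by
    \<open>ts\<close>, so its bound must hold for every accumulator.\<close>
  obtain c f s l where v: "val (finds_timed S m lg ts acc) = (c, f, s, l)"
    by (metis prod_cases4)
  have "time (finds_timed S m lg ts acc) + 16 * length ts \<le> 1 + 32 * length (leaves (Node ts))"
    using Cons by simp
  moreover have "time (find_timed S m lg u c) + 20 \<le> 32 * length (leaves u)"
    using Cons.prems by simp
  ultimately show ?case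
    by (simp add: timed_simps v split: prod.split)
qed (simp add: timed_simps)

text \<open>At an internal node the two children save at least 32 units. At most 12 go to two calls,
  \<open>Lroot_timed\<close>, the comparison and the prepending, which leaves the 20 to pass
  on.\<close>

lemma time_find_timed:
  assumes "thesaurus t" "proper_links t"
  shows "time (find_timed S m lg t acc) + 20 \<le> 32 * length (leaves t)"
  using assms
proof (induction t arbitrary: acc)
  case (Leaf n)
  then show ?case
    using time_Lroot_timed[of m lg "count S n" 1] by (simp add: timed_simps)
next
  case (Node ts)
  have "time (finds_timed S m lg ts acc) + 16 * length ts \<le> 1 + 32 * length (leaves (Node ts))"
    using Node thesaurus_child proper_links_child by (intro time_finds_timed) blast
  moreover obtain c f s l where "val (finds_timed S m lg ts acc) = (c, f, s, l)"
    by (metis prod_cases4)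
  ultimately show ?case
    using two_le_length_children[OF Node.prems] time_Lroot_timed[of m lg f s]
    by (simp add: timed_simps)
qed

lemma time_find_mdl_timed:
  assumes "thesaurus t" "proper_links t"
  shows "time (find_mdl_timed S t) \<le> 40 * length (leaves t)"
proof -
  define m where "m = val (sample_size_timed S t)"
  have "time (sample_size_timed S t) + 6 \<le> 8 * length (leaves t)"
    by (rule time_sample_size_timed[OF assms])
  moreover have "time (find_timed S m (log 2 (real m)) t []) + 20 \<le> 32 * length (leaves t)"
    by (rule time_find_timed[OF assms])
  \<comment> \<open>The factor is 8 + 32; the slack 6 + 20 covers the outer call and the
    logarithm.\<close>
  ultimately show ?thesis
    by (simp add: find_mdl_timed_def timed_simps m_def split: prod.split)
qed

theorem proposition1:
  shows "\<exists>K::nat. \<forall>(T :: 'a tree) (S :: 'a multiset).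
    thesaurus T \<longrightarrow> S \<noteq> {#} \<longrightarrow> set_mset S \<subseteq> nouns T \<longrightarrow>
      val (find_mdl_timed S T) = find_mdl S T
      \<and> (proper_links T \<longrightarrow> time (find_mdl_timed S T) \<le> K * length (leaves T))
      \<and> distinct (find_mdl S T)
      \<and> tree_cut_model T (set (find_mdl S T), mle S)
      \<and> (\<forall>\<Gamma>'. tree_cut T \<Gamma>' \<longrightarrow>
            description_length T (set (find_mdl S T), mle S) S
              \<le> description_length T (\<Gamma>', mle S) S)"
proof (intro exI[of _ 40] allI impI conjI)
  fix T :: "'a tree" and S :: "'a multiset"
  assume T: "thesaurus T" and ne: "S \<noteq> {#}" and S: "set_mset S \<subseteq> nouns T"
  note cut = tree_cut_find_mdl[OF T]
  show "val (find_mdl_timed S T) = find_mdl S T"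
    by (rule val_find_mdl_timed[OF T S])
  show "time (find_mdl_timed S T) \<le> 40 * length (leaves T)" if "proper_links T"
    by (rule time_find_mdl_timed[OF T that])
  show "distinct (find_mdl S T)"
    by (rule distinct_find_mdl[OF T])
  show "tree_cut_model T (set (find_mdl S T), mle S)"
    by (rule tree_cut_model_mle[OF T cut S ne])
  show "description_length T (set (find_mdl S T), mle S) S \<le> description_length T (\<Gamma>', mle S) S"
    if "tree_cut T \<Gamma>'" for \<Gamma>'
    \<comment> \<open>Both sides become the same constant plus a sum of node costs.\<close>
    unfolding description_length_eq[OF S] Lprime_eq[OF T cut] Lprime_eq[OF T that]
    using sum_node_cost_find_mdl_le[OF T that] by simp
qed

end
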